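(* Let $\epsilon>0$. The approximate point queue models $\epsilon$-PQM1 and $\epsilon$-PQM2 are always well-defined with any $\epsilon$. $\epsilon$-PQM3 is well-defined if and only if $\epsilon\le\frac{\Lambda}{\sigma(t)}$. $\epsilon$-PQM4 is well-defined if and only if $\epsilon\le\frac{\Lambda}{\delta(t)}$. Thus all approximate models are well-defined if $\epsilon$ satisfies $$\epsilon\le\frac{\Lambda}{\max_t\{\delta(t),\sigma(t)\}}.$$
   Context: A point queue has storage capacity $\Lambda>0$, origin demand $\delta(t)\ge0$ and destination supply $\sigma(t)\ge0$ (continuous functions of $t\ge0$), and initial size $\Lambda_0\in[0,\Lambda]$. Conditions such as $\epsilon\le\Lambda/\sigma(t)$ are required for every $t$, with $\Lambda/0=\infty$. State variables: queue size $\lambda_\epsilon(t)=F_\epsilon(t)-G_\epsilon(t)$, with cumulative in- and out-flows $F_\epsilon,G_\epsilon$; $\lambda_\epsilon(0)=F_\epsilon(0)=\Lambda_0$, $G_\epsilon(0)=0$. Demand and supply functions: - $\epsilon$-PQM1: $d_\epsilon=\delta(t)+\frac{\lambda_\epsilon(t)}{\epsilon}$, $s_\epsilon=\sigma(t)+\frac{\Lambda-\lambda_\epsilon(t)}{\epsilon}$; - $\epsilon$-PQM2: $d_\epsilon=\frac{\lambda_\epsilon(t)}{\epsilon}$, $s_\epsilon=\frac{\Lambda-\lambda_\epsilon(t)}{\epsilon}$; - $\epsilon$-PQM3: $d_\epsilon=\delta(t)+\frac{\lambda_\epsilon(t)}{\epsilon}$, $s_\epsilon=\frac{\Lambda-\lambda_\epsilon(t)}{\epsilon}$;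 - $\epsilon$-PQM4: $d_\epsilon=\frac{\lambda_\epsilon(t)}{\epsilon}$, $s_\epsilon=\sigma(t)+\frac{\Lambda-\lambda_\epsilon(t)}{\epsilon}$. Each model has two formulations: (A) $\frac{d}{dt}\lambda_\epsilon=\min\{\delta,s_\epsilon\}-\min\{d_\epsilon,\sigma\}$; (B) $\frac{d}{dt}F_\epsilon=\min\{\delta,s_\epsilon\}$, $\frac{d}{dt}G_\epsilon=\min\{d_\epsilon,\sigma\}$. A model is well-defined if and only if $\lambda_\epsilon(t)$ is always between $0$ and $\Lambda$ in (A), or $G_\epsilon(t)\le F_\epsilon(t)\le G_\epsilon(t)+\Lambda$ in (B), whatever the initial size $\Lambda_0\in[0,\Lambda]$. Data not appearing in a stated condition are arbitrary: the "if and only if" for $\epsilon$-PQM3 concerns well-definedness for given $\sigma$ and all origin demands $\delta\ge0$; the one for $\epsilon$-PQM4 concerns well-definedness for given $\delta$ and all destination supplies $\sigma\ge0$; $\epsilon$-PQM1 and $\epsilon$-PQM2 are well-defined for all $\delta,\sigma\ge0$. *)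

theory Defs
  imports "HOL-Analysis.Analysis"
begin

text \<open>Time is \<open>{0..}\<close>; values of functions of time at negative arguments are irrelevant.\<close>

definition rate_fun :: "(real \<Rightarrow> real) \<Rightarrow> bool" where
  "rate_fun r \<longleftrightarrow> continuous_on {0..} r \<and> (\<forall>t\<ge>0. 0 \<le> r t)"

datatype pqm = PQM1 | PQM2 | PQM3 | PQM4

text \<open>In the following, \<open>x\<close> is the queue size at time \<open>t\<close>.\<close>

fun demand_rate :: "pqm \<Rightarrow> real \<Rightarrow> (real \<Rightarrow> real) \<Rightarrow> real \<Rightarrow> real \<Rightarrow> real" where
  "demand_rate PQM1 \<epsilon> \<delta> t x = \<delta> t + x / \<epsilon>"
| "demand_rate PQM2 \<epsilon> \<delta> t x = x / \<epsilon>"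
| "demand_rate PQM3 \<epsilon> \<delta> t x = \<delta> t + x / \<epsilon>"
| "demand_rate PQM4 \<epsilon> \<delta> t x = x / \<epsilon>"

fun supply_rate :: "pqm \<Rightarrow> real \<Rightarrow> real \<Rightarrow> (real \<Rightarrow> real) \<Rightarrow> real \<Rightarrow> real \<Rightarrow> real" where
  "supply_rate PQM1 \<Lambda> \<epsilon> \<sigma> t x = \<sigma> t + (\<Lambda> - x) / \<epsilon>"
| "supply_rate PQM2 \<Lambda> \<epsilon> \<sigma> t x = (\<Lambda> - x) / \<epsilon>"
| "supply_rate PQM3 \<Lambda> \<epsilon> \<sigma> t x = (\<Lambda> - x) / \<epsilon>"
| "supply_rate PQM4 \<Lambda> \<epsilon> \<sigma> t x = \<sigma> t + (\<Lambda> - x) / \<epsilon>"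

definition inflow ::
  "pqm \<Rightarrow> real \<Rightarrow> real \<Rightarrow> (real \<Rightarrow> real) \<Rightarrow> (real \<Rightarrow> real) \<Rightarrow> real \<Rightarrow> real \<Rightarrow> real" where
  "inflow m \<Lambda> \<epsilon> \<delta> \<sigma> t x = min (\<delta> t) (supply_rate m \<Lambda> \<epsilon> \<sigma> t x)"

definition outflow ::
  "pqm \<Rightarrow> real \<Rightarrow> (real \<Rightarrow> real) \<Rightarrow> (real \<Rightarrow> real) \<Rightarrow> real \<Rightarrow> real \<Rightarrow> real" where
  "outflow m \<epsilon> \<delta> \<sigma> t x = min (demand_rate m \<epsilon> \<delta> t x) (\<sigma> t)"

definition solution_A ::
  "pqm \<Rightarrow> real \<Rightarrow> real \<Rightarrow> (real \<Rightarrow> real) \<Rightarrow> (real \<Rightarrow> real) \<Rightarrow> real \<Rightarrow> (real \<Rightarrow> real) \<Rightarrow> bool" where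
  "solution_A m \<Lambda> \<epsilon> \<delta> \<sigma> \<Lambda>0 l \<longleftrightarrow> l 0 = \<Lambda>0 \<and>
    (\<forall>t\<ge>0. (l has_real_derivative
      inflow m \<Lambda> \<epsilon> \<delta> \<sigma> t (l t) - outflow m \<epsilon> \<delta> \<sigma> t (l t)) (at t within {0..}))"

definition solution_B ::
  "pqm \<Rightarrow> real \<Rightarrow> real \<Rightarrow> (real \<Rightarrow> real) \<Rightarrow> (real \<Rightarrow> real) \<Rightarrow> real \<Rightarrow>
    (real \<Rightarrow> real) \<Rightarrow> (real \<Rightarrow> real) \<Rightarrow> bool" where
  "solution_B m \<Lambda> \<epsilon> \<delta> \<sigma> \<Lambda>0 F G \<longleftrightarrow> F 0 = \<Lambda>0 \<and> G 0 = 0 \<and>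
    (\<forall>t\<ge>0. (F has_real_derivative inflow m \<Lambda> \<epsilon> \<delta> \<sigma> t (F t - G t)) (at t within {0..}) \<and>
           (G has_real_derivative outflow m \<epsilon> \<delta> \<sigma> t (F t - G t)) (at t within {0..}))"

text \<open>For \<open>\<epsilon> > 0\<close> and continuous \<open>\<delta>\<close>, \<open>\<sigma>\<close> the right-hand sides are continuous in time and globally
  Lipschitz in the queue size, so for each initial size there is exactly one solution on \<open>{0..}\<close>.
  The quantification over solutions below therefore refers to that one.\<close>

definition well_defined_A ::
  "pqm \<Rightarrow> real \<Rightarrow> real \<Rightarrow> (real \<Rightarrow> real) \<Rightarrow> (real \<Rightarrow> real) \<Rightarrow> bool" where
  "well_defined_A m \<Lambda> \<epsilon> \<delta> \<sigma> \<longleftrightarrow>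
    (\<forall>\<Lambda>0\<in>{0..\<Lambda>}. \<forall>l. solution_A m \<Lambda> \<epsilon> \<delta> \<sigma> \<Lambda>0 l \<longrightarrow> (\<forall>t\<ge>0. 0 \<le> l t \<and> l t \<le> \<Lambda>))"

definition well_defined_B ::
  "pqm \<Rightarrow> real \<Rightarrow> real \<Rightarrow> (real \<Rightarrow> real) \<Rightarrow> (real \<Rightarrow> real) \<Rightarrow> bool" where
  "well_defined_B m \<Lambda> \<epsilon> \<delta> \<sigma> \<longleftrightarrow>
    (\<forall>\<Lambda>0\<in>{0..\<Lambda>}. \<forall>F G. solution_B m \<Lambda> \<epsilon> \<delta> \<sigma> \<Lambda>0 F G \<longrightarrow>
      (\<forall>t\<ge>0. G t \<le> F t \<and> F t \<le> G t + \<Lambda>))"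

text \<open>Bounds of the form \<open>\<epsilon> \<le> \<Lambda> / r\<close> are stated in \<^typ>\<open>ereal\<close>, where \<open>\<Lambda> / 0 = \<infinity>\<close> for \<open>\<Lambda> > 0\<close>
  (in \<^typ>\<open>real\<close> it would be \<open>0\<close>) and \<open>\<Lambda> / \<infinity> = 0\<close>.\<close>

lemma "0 < \<Lambda> \<Longrightarrow> ereal \<Lambda> / 0 = \<infinity>" and "ereal \<Lambda> / \<infinity> = 0"
  by (simp_all add: divide_ereal_def)

end

(* For negative queue sizes the right-hand side of formulation (A) is nonnegative (for PQM3 this is where
   the bound on the supply enters), so 0 is a barrier. The substitution x -> Lambda - x with demand and
   supply exchanged swaps PQM3 with PQM4 and fixes PQM1 and PQM2, so it turns lower bounds into upper ones.
   For necessity in PQM3, start empty and let the demand balance the outflow until a time t0 at which the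
   supply exceeds Lambda / epsilon. A demand growing fast enough afterwards makes the equation linear and
   lets the outflow exceed Lambda / epsilon, so that the explicit solution becomes negative. *)
theory Submission imports Defs begin

section \<open>Calculus on the half-line\<close>

lemma at_within_atLeast_interior:
  fixes a t :: real
  assumes "a < t"
  shows "at t within {a..} = at t"
  using assms by (intro at_within_interior) (simp add: interior_Ici)

text \<open>If \<open>l t < 0\<close>, take the last time \<open>m\<close> in \<open>{0..t}\<close>
  with \<open>0 \<le> l m\<close>. After \<open>m\<close> the function is negative, so its
  derivative is nonnegative there and \<open>l m \<le> l t\<close>, a contradiction.\<close>

lemma derivative_nonneg_barrier:
  fixes l l' :: "real \<Rightarrow> real"
  assumes deriv: "\<And>t. 0 \<le> t \<Longrightarrow> (l has_real_derivative l' t) (at t within {0..})"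
    and init: "0 \<le> l 0"
    and push: "\<And>t. 0 \<le> t \<Longrightarrow> l t < 0 \<Longrightarrow> 0 \<le> l' t"
    and "0 \<le> t"
  shows "0 \<le> l t"
proof (rule ccontr)
  assume "\<not> 0 \<le> l t"
  have cont: "continuous_on {0..} l"
    using deriv by (auto simp: continuous_on_eq_continuous_within intro: DERIV_continuous)
  define S where "S = {s \<in> {0..t}. 0 \<le> l s}"
  have "closed S"
    unfolding S_def
    by (rule continuous_on_closed_Collect_le[OF continuous_on_const continuous_on_subset[OF cont]]) auto
  moreover have "bounded S"
    by (rule bounded_subset[OF bounded_closed_interval[of 0 t]]) (auto simp: S_def)
  ultimately have "compact S"
    by (simp add: compact_eq_bounded_closed)
  moreover have "0 \<in> S"
    using init \<open>0 \<le> t\<close> by (simp add: S_def)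
  then have "S \<noteq> {}"
    by auto
  ultimately obtain m where "m \<in> S" and sup: "\<forall>s\<in>S. s \<le> m"
    by (rule compact_attains_sup[THEN bexE])
  then have m: "0 \<le> m" "m \<le> t" "0 \<le> l m"
    by (simp_all add: S_def)
  have "l m \<le> l t"
  proof (rule DERIV_nonneg_imp_increasing_open[where f = l])
    fix s assume s: "m < s" "s < t"
    have "0 \<le> s" "s \<le> t"
      using s m by simp_all
    then have "l s < 0"
      using sup s by (force simp: S_def)
    then have "0 \<le> l' s"
      using push \<open>0 \<le> s\<close> by blast
    moreover have "(l has_real_derivative l' s) (at s)"
      using deriv[of s] at_within_atLeast_interior[of 0 s] s m by simp
    ultimately show "\<exists>y. (l has_real_derivative y) (at s) \<and> 0 \<le> y"
      by blast
  next
    show "continuous_on {m..t} l"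
      by (rule continuous_on_subset[OF cont]) (use m in auto)
  qed (use m in simp)
  with m \<open>\<not> 0 \<le> l t\<close> show False
    by simp
qed

text \<open>The fundamental theorem of calculus holds on \<open>{a..t + 1}\<close>, and this
  interval agrees with the half-line within distance 1 of \<open>t\<close>.\<close>

lemma integral_has_real_derivative_atLeast:
  fixes f :: "real \<Rightarrow> real"
  assumes "continuous_on {a..} f" and "a \<le> t"
  shows "((\<lambda>t. integral {a..t} f) has_real_derivative f t) (at t within {a..})"
proof -
  have "((\<lambda>t. integral {a..t} f) has_real_derivative f t) (at t within {a..t + 1})"
    using assms by (intro integral_has_real_derivative continuous_on_subset[OF assms(1)]) auto
  moreover have "at t within {a..t + 1} = at t within {a..}"
    by (rule at_within_nhd[of t "{t - 1<..<t + 1}"]) auto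
  ultimately show ?thesis
    by simp
qed

section \<open>Equivalence of formulations (A) and (B)\<close>

lemma continuous_on_outflow:
  assumes "rate_fun \<delta>" "rate_fun \<sigma>" "continuous_on {0..} l" "0 < \<epsilon>"
  shows "continuous_on {0..} (\<lambda>t. outflow m \<epsilon> \<delta> \<sigma> t (l t))"
  using assms unfolding outflow_def rate_fun_def
  by (cases m) (auto intro!: continuous_intros)

lemma solution_B_imp_A:
  assumes "solution_B m \<Lambda> \<epsilon> \<delta> \<sigma> \<Lambda>0 F G"
  shows "solution_A m \<Lambda> \<epsilon> \<delta> \<sigma> \<Lambda>0 (\<lambda>t. F t - G t)"
  using assms unfolding solution_A_def solution_B_def by (auto intro!: DERIV_diff)

text \<open>Integrating the outflow along \<open>l\<close> recovers \<open>G\<close>, and then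
  \<open>F\<close> must be \<open>l + G\<close>.\<close>

lemma solution_A_imp_B:
  assumes "rate_fun \<delta>" "rate_fun \<sigma>" "0 < \<epsilon>" and sol: "solution_A m \<Lambda> \<epsilon> \<delta> \<sigma> \<Lambda>0 l"
  obtains F G where "solution_B m \<Lambda> \<epsilon> \<delta> \<sigma> \<Lambda>0 F G" "\<And>t. F t - G t = l t"
proof -
  define out where "out t = outflow m \<epsilon> \<delta> \<sigma> t (l t)" for t
  define G where "G t = integral {0..t} out" for t
  have "continuous_on {0..} l"
    using sol by (auto simp: solution_A_def continuous_on_eq_continuous_within intro: DERIV_continuous)
  then have "continuous_on {0..} out"
    unfolding out_def using assms by (intro continuous_on_outflow)
  then have G: "(G has_real_derivative out t) (at t within {0..})" if "0 \<le> t" for t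
    unfolding G_def using that by (rule integral_has_real_derivative_atLeast)
  have "((\<lambda>t. l t + G t) has_real_derivative inflow m \<Lambda> \<epsilon> \<delta> \<sigma> t (l t)) (at t within {0..})"
    if "0 \<le> t" for t
    using DERIV_add[OF _ G[OF that], of l] sol that by (fastforce simp: solution_A_def out_def)
  moreover have "G 0 = 0" "l 0 = \<Lambda>0"
    using sol by (simp_all add: G_def solution_A_def)
  ultimately have "solution_B m \<Lambda> \<epsilon> \<delta> \<sigma> \<Lambda>0 (\<lambda>t. l t + G t) G"
    using G by (simp add: solution_B_def out_def)
  then show ?thesis
    by (rule that) simp
qed

text \<open>Solutions of the two formulations correspond through \<open>l = F - G\<close>, which
  also translates the bounds. This reduces all claims about (B) to (A).\<close>

lemma well_defined_B_iff_A:
  assumes "rate_fun \<delta>" "rate_fun \<sigma>" "0 < \<epsilon>"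
  shows "well_defined_B m \<Lambda> \<epsilon> \<delta> \<sigma> \<longleftrightarrow> well_defined_A m \<Lambda> \<epsilon> \<delta> \<sigma>"
proof
  assume B: "well_defined_B m \<Lambda> \<epsilon> \<delta> \<sigma>"
  show "well_defined_A m \<Lambda> \<epsilon> \<delta> \<sigma>"
    unfolding well_defined_A_def
  proof (intro ballI allI impI)
    fix \<Lambda>0 l and t :: real
    assume "\<Lambda>0 \<in> {0..\<Lambda>}" "solution_A m \<Lambda> \<epsilon> \<delta> \<sigma> \<Lambda>0 l" "0 \<le> t"
    moreover obtain F G where "solution_B m \<Lambda> \<epsilon> \<delta> \<sigma> \<Lambda>0 F G" and l: "\<And>t. F t - G t = l t"
      using solution_A_imp_B assms calculation(2) by blast
    ultimately have "G t \<le> F t" "F t \<le> G t + \<Lambda>"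
      using B unfolding well_defined_B_def by blast+
    then show "0 \<le> l t \<and> l t \<le> \<Lambda>"
      using l[of t] by simp
  qed
next
  assume A: "well_defined_A m \<Lambda> \<epsilon> \<delta> \<sigma>"
  show "well_defined_B m \<Lambda> \<epsilon> \<delta> \<sigma>"
    unfolding well_defined_B_def
  proof (intro ballI allI impI)
    fix \<Lambda>0 F G and t :: real
    assume "\<Lambda>0 \<in> {0..\<Lambda>}" "solution_B m \<Lambda> \<epsilon> \<delta> \<sigma> \<Lambda>0 F G" "0 \<le> t"
    then have "0 \<le> F t - G t \<and> F t - G t \<le> \<Lambda>"
      using A solution_B_imp_A unfolding well_defined_A_def by blast
    then show "G t \<le> F t \<and> F t \<le> G t + \<Lambda>"
      by simp
  qed
qed

section \<open>Duality between queue and free storage\<close>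

text \<open>The model obeyed by the free storage \<open>\<Lambda> - x\<close>: holes enter when the
  queue discharges and leave when it fills, so origin demand and destination supply trade
  places.\<close>

fun dual_pqm :: "pqm \<Rightarrow> pqm" where
  "dual_pqm PQM1 = PQM1"
| "dual_pqm PQM2 = PQM2"
| "dual_pqm PQM3 = PQM4"
| "dual_pqm PQM4 = PQM3"

lemma dual_pqm_involutive [simp]: "dual_pqm (dual_pqm m) = m"
  by (cases m) auto

lemma inflow_dual: "inflow (dual_pqm m) \<Lambda> \<epsilon> \<sigma> \<delta> t (\<Lambda> - x) = outflow m \<epsilon> \<delta> \<sigma> t x"
  by (cases m) (auto simp: inflow_def outflow_def min.commute)

lemma outflow_dual: "outflow (dual_pqm m) \<epsilon> \<sigma> \<delta> t (\<Lambda> - x) = inflow m \<Lambda> \<epsilon> \<delta> \<sigma> t x"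
  by (cases m) (auto simp: inflow_def outflow_def min.commute)

lemma solution_A_dual:
  assumes "solution_A m \<Lambda> \<epsilon> \<delta> \<sigma> \<Lambda>0 l"
  shows "solution_A (dual_pqm m) \<Lambda> \<epsilon> \<sigma> \<delta> (\<Lambda> - \<Lambda>0) (\<lambda>t. \<Lambda> - l t)"
  using assms unfolding solution_A_def inflow_dual outflow_dual
  by (auto intro!: derivative_eq_intros)

text \<open>Reflection at \<open>\<Lambda> / 2\<close> preserves both the range of initial sizes and
  the required bounds. Since the duality is an involution, this implication already yields the
  equivalence.\<close>

lemma well_defined_A_dual_imp:
  assumes "well_defined_A m \<Lambda> \<epsilon> \<delta> \<sigma>"
  shows "well_defined_A (dual_pqm m) \<Lambda> \<epsilon> \<sigma> \<delta>"
  unfolding well_defined_A_def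
proof (intro ballI allI impI)
  fix \<Lambda>0 l and t :: real
  assume "\<Lambda>0 \<in> {0..\<Lambda>}" "solution_A (dual_pqm m) \<Lambda> \<epsilon> \<sigma> \<delta> \<Lambda>0 l" "0 \<le> t"
  moreover from this have "solution_A m \<Lambda> \<epsilon> \<delta> \<sigma> (\<Lambda> - \<Lambda>0) (\<lambda>t. \<Lambda> - l t)"
    using solution_A_dual by fastforce
  moreover have "\<Lambda> - \<Lambda>0 \<in> {0..\<Lambda>}"
    using calculation(1) by simp
  ultimately have "0 \<le> \<Lambda> - l t \<and> \<Lambda> - l t \<le> \<Lambda>"
    using assms unfolding well_defined_A_def by blast
  then show "0 \<le> l t \<and> l t \<le> \<Lambda>"
    by simp
qed

lemma well_defined_A_dual:
  "well_defined_A (dual_pqm m) \<Lambda> \<epsilon> \<sigma> \<delta> \<longleftrightarrow> well_defined_A m \<Lambda> \<epsilon> \<delta> \<sigma>"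
  by (metis dual_pqm_involutive well_defined_A_dual_imp)

section \<open>Sufficiency of the bounds\<close>

text \<open>In PQM2 and PQM4 the demand \<open>x / \<epsilon>\<close> is negative, hence so is the
  outflow, while the inflow is nonnegative. In PQM1 and PQM3 the two minima compare termwise:
  \<open>\<delta> t + x / \<epsilon>\<close> lies below \<open>\<delta> t\<close>, and
  \<open>\<sigma> t\<close> lies below the supply, for PQM3 because
  \<open>\<sigma> t \<le> \<Lambda> / \<epsilon>\<close>.\<close>

lemma outflow_le_inflow:
  assumes "0 \<le> \<Lambda>" "0 < \<epsilon>" "0 \<le> \<delta> t" "0 \<le> \<sigma> t" "x < 0"
    and "m = PQM3 \<Longrightarrow> \<epsilon> * \<sigma> t \<le> \<Lambda>"
  shows "outflow m \<epsilon> \<delta> \<sigma> t x \<le> inflow m \<Lambda> \<epsilon> \<delta> \<sigma> t x"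
proof -
  define d s where "d = x / \<epsilon>" and "s = (\<Lambda> - x) / \<epsilon>"
  have "d < 0" "0 < s"
    using assms by (simp_all add: d_def s_def divide_neg_pos)
  moreover have "\<sigma> t \<le> s" if "m = PQM3"
    using assms that by (simp add: s_def pos_le_divide_eq mult.commute)
  ultimately show ?thesis
    using \<open>0 \<le> \<delta> t\<close> \<open>0 \<le> \<sigma> t\<close>
    by (cases m) (auto simp: inflow_def outflow_def min_def simp flip: d_def s_def)
qed

lemma solution_A_nonneg:
  assumes "0 \<le> \<Lambda>" "0 < \<epsilon>" "rate_fun \<delta>" "rate_fun \<sigma>" "0 \<le> \<Lambda>0" "0 \<le> t"
    and sol: "solution_A m \<Lambda> \<epsilon> \<delta> \<sigma> \<Lambda>0 l"
    and "m = PQM3 \<Longrightarrow> \<forall>t\<ge>0. \<epsilon> * \<sigma> t \<le> \<Lambda>"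
  shows "0 \<le> l t"
proof (rule derivative_nonneg_barrier[where l = l and t = t])
  show "(l has_real_derivative inflow m \<Lambda> \<epsilon> \<delta> \<sigma> t (l t) - outflow m \<epsilon> \<delta> \<sigma> t (l t)) (at t within {0..})"
    if "0 \<le> t" for t
    using sol that by (simp add: solution_A_def)
  show "0 \<le> inflow m \<Lambda> \<epsilon> \<delta> \<sigma> t (l t) - outflow m \<epsilon> \<delta> \<sigma> t (l t)" if "0 \<le> t" "l t < 0" for t
    using outflow_le_inflow[of \<Lambda> \<epsilon> \<delta> t \<sigma> "l t" m] assms that by (simp add: rate_fun_def)
qed (use assms in \<open>auto simp: solution_A_def\<close>)

lemma well_defined_A_sufficient:
  assumes "0 \<le> \<Lambda>" "0 < \<epsilon>" "rate_fun \<delta>" "rate_fun \<sigma>"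
    and "m = PQM3 \<Longrightarrow> \<forall>t\<ge>0. \<epsilon> * \<sigma> t \<le> \<Lambda>"
    and "m = PQM4 \<Longrightarrow> \<forall>t\<ge>0. \<epsilon> * \<delta> t \<le> \<Lambda>"
  shows "well_defined_A m \<Lambda> \<epsilon> \<delta> \<sigma>"
  unfolding well_defined_A_def
proof (intro ballI allI impI)
  fix \<Lambda>0 l and t :: real
  assume init: "\<Lambda>0 \<in> {0..\<Lambda>}" and sol: "solution_A m \<Lambda> \<epsilon> \<delta> \<sigma> \<Lambda>0 l" and "0 \<le> t"
  have "0 \<le> l t"
    using solution_A_nonneg[OF _ _ _ _ _ _ sol] assms init \<open>0 \<le> t\<close> by auto
  \<comment> \<open>The upper bound is nonnegativity of the free storage. Its model has supply
    \<open>\<delta>\<close>, so the condition needed for a dual PQM3 is the one assumed on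
    \<open>\<delta>\<close> for PQM4.\<close>
  moreover have "m = PQM4" if "dual_pqm m = PQM3"
    using that by (cases m) auto
  then have "0 \<le> \<Lambda> - l t"
    using solution_A_nonneg[OF _ _ _ _ _ _ solution_A_dual[OF sol]] assms init \<open>0 \<le> t\<close> by auto
  ultimately show "0 \<le> l t \<and> l t \<le> \<Lambda>"
    by simp
qed

section \<open>Necessity of the bound for PQM3\<close>

lemma PQM3_not_well_defined:
  assumes "0 < \<Lambda>" "0 < \<epsilon>" and \<sigma>: "rate_fun \<sigma>" and t0: "0 \<le> t0" "\<Lambda> < \<epsilon> * \<sigma> t0"
  obtains \<delta> where "rate_fun \<delta>" "\<not> well_defined_A PQM3 \<Lambda> \<epsilon> \<delta> \<sigma>"
proof -
  define c where "c = \<Lambda> / \<epsilon>"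
  have c: "0 < c" "c < \<sigma> t0"
    using assms by (simp_all add: c_def pos_divide_less_eq mult.commute)
  have \<sigma>_cont: "continuous_on {0..} \<sigma>" and \<sigma>_nonneg: "\<And>t. 0 \<le> t \<Longrightarrow> 0 \<le> \<sigma> t"
    using \<sigma> by (auto simp: rate_fun_def)
  \<comment> \<open>\<open>g\<close> vanishes up to \<open>t0\<close> and is \<open>c\<close> minus the intended outflow afterwards;
    \<open>l\<close> solves \<open>l' = g - l / \<epsilon>\<close>, and the demand is then read off from \<open>l\<close>.\<close>
  define g where "g t = c - min (\<sigma> (max t t0)) (c + (max t t0 - t0))" for t
  \<comment> \<open>Integrating factor for the linear equation: \<open>y t\<close> is
    \<open>exp (t / \<epsilon>) * l t\<close>.\<close>
  define y where "y t = integral {0..t} (\<lambda>s. exp (s / \<epsilon>) * g s)" for t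
  define l where "l t = exp (- t / \<epsilon>) * y t" for t
  \<comment> \<open>The clamps at \<open>t0\<close> join both phases in one formula, which makes
    continuity immediate; at \<open>t0\<close> the pieces meet in the value \<open>c\<close> because
    \<open>c < \<sigma> t0\<close>. The ramp \<open>t - t0\<close> lifts the demand to at least the
    supply \<open>c - l t / \<epsilon>\<close>.\<close>
  define \<delta> where "\<delta> t = min c (\<sigma> (min t t0)) + (max t t0 - t0) - l t / \<epsilon>" for t
  have g_before: "g t = 0" if "t \<le> t0" for t
    using that c by (simp add: g_def)
  have g_cont: "continuous_on {0..} g"
    unfolding g_def using t0
    by (intro continuous_intros continuous_on_compose2[OF \<sigma>_cont]) auto
  have y_deriv: "(y has_real_derivative exp (t / \<epsilon>) * g t) (at t within {0..})" if "0 \<le> t" for t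
    unfolding y_def using that
    by (intro integral_has_real_derivative_atLeast[where f = "\<lambda>s. exp (s / \<epsilon>) * g s"]
        continuous_intros g_cont) (use assms in auto)
  have l_deriv: "(l has_real_derivative g t - l t / \<epsilon>) (at t within {0..})" if "0 \<le> t" for t
  proof -
    have E: "((\<lambda>t. exp (- t / \<epsilon>)) has_real_derivative - exp (- t / \<epsilon>) / \<epsilon>) (at t within {0..})"
      using assms by (auto intro!: derivative_eq_intros)
    show ?thesis
      unfolding l_def
      by (rule DERIV_cong[OF DERIV_mult[OF E y_deriv[OF that]]]) (simp add: exp_minus)
  qed
  have y_before: "y t = 0" if "t \<le> t0" for t
  proof -
    have "y t = integral {0..t} (\<lambda>s. 0)"
      unfolding y_def using g_before that by (intro integral_cong) auto
    then show ?thesis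
      by simp
  qed
  then have l_before: "l t = 0" if "t \<le> t0" for t
    using that by (simp add: l_def)
  \<comment> \<open>Needed for \<open>0 \<le> \<delta> t\<close> after \<open>t0\<close>, where
    \<open>l t / \<epsilon>\<close> is subtracted from \<open>c\<close>. It is again a barrier:
    since \<open>g \<le> c\<close>, the derivative of \<open>l\<close> is at most 0 wherever
    \<open>l\<close> exceeds \<open>\<Lambda>\<close>.\<close>
  have l_le: "l t \<le> \<Lambda>" if "0 \<le> t" for t
  proof -
    have "0 \<le> \<Lambda> - l t"
    proof (rule derivative_nonneg_barrier[where l = "\<lambda>t. \<Lambda> - l t" and t = t and l' = "\<lambda>t. - (g t - l t / \<epsilon>)"])
      show "((\<lambda>t. \<Lambda> - l t) has_real_derivative - (g t - l t / \<epsilon>)) (at t within {0..})" if "0 \<le> t" for t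
        using l_deriv[OF that] by (auto intro!: derivative_eq_intros)
      show "0 \<le> - (g t - l t / \<epsilon>)" if "0 \<le> t" "\<Lambda> - l t < 0" for t
      proof -
        have "g t \<le> c"
          using \<sigma>_nonneg[of "max t t0"] that c by (simp add: g_def)
        also have "c \<le> l t / \<epsilon>"
          using that assms by (simp add: c_def divide_right_mono)
        finally show ?thesis
          by simp
      qed
    qed (use that assms t0 l_before in auto)
    then show ?thesis
      by simp
  qed
  have \<delta>_before: "\<delta> t = min c (\<sigma> t)" if "t \<le> t0" for t
    using that l_before by (simp add: \<delta>_def)
  have \<delta>_after: "\<delta> t = c + (t - t0) - l t / \<epsilon>" if "t0 < t" for t
    using that c by (simp add: \<delta>_def)
  have "continuous_on {0..} l"
    using l_deriv by (auto simp: continuous_on_eq_continuous_within intro: DERIV_continuous)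
  then have "continuous_on {0..} \<delta>"
    unfolding \<delta>_def using t0 assms
    by (intro continuous_intros continuous_on_compose2[OF \<sigma>_cont]) auto
  moreover have "0 \<le> \<delta> t" if "0 \<le> t" for t
  proof (cases "t \<le> t0")
    case True
    then show ?thesis
      using \<delta>_before \<sigma>_nonneg that c by simp
  next
    case False
    have "l t / \<epsilon> \<le> c"
      using l_le[OF that] assms by (simp add: c_def divide_right_mono)
    then show ?thesis
      using \<delta>_after False by simp
  qed
  ultimately have "rate_fun \<delta>"
    by (simp add: rate_fun_def)
  moreover have "solution_A PQM3 \<Lambda> \<epsilon> \<delta> \<sigma> 0 l"
  proof -
    have "inflow PQM3 \<Lambda> \<epsilon> \<delta> \<sigma> t (l t) - outflow PQM3 \<epsilon> \<delta> \<sigma> t (l t) = g t - l t / \<epsilon>" if "0 \<le> t" for t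
    proof (cases "t \<le> t0")
      case True
      \<comment> \<open>The queue is empty and both flows equal
        \<open>min c (\<sigma> t)\<close>.\<close>
      then show ?thesis
        by (auto simp: inflow_def outflow_def l_before \<delta>_before g_before c_def[symmetric])
    next
      case False
      \<comment> \<open>Now the supply is the smaller term of the inflow. In the outflow
        \<open>l t / \<epsilon>\<close> cancels, leaving the minimum of \<open>c + (t - t0)\<close>
        and \<open>\<sigma> t\<close>.\<close>
      then have "inflow PQM3 \<Lambda> \<epsilon> \<delta> \<sigma> t (l t) = c - l t / \<epsilon>"
        by (simp add: inflow_def \<delta>_after c_def diff_divide_distrib)
      moreover have "outflow PQM3 \<epsilon> \<delta> \<sigma> t (l t) = c - g t"
        using False by (simp add: outflow_def \<delta>_after g_def min.commute)
      ultimately show ?thesis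
        by simp
    qed
    then show ?thesis
      using l_deriv l_before t0 by (simp add: solution_A_def)
  qed
  moreover obtain t where "0 \<le> t" "\<not> 0 \<le> l t"
  proof -
    \<comment> \<open>By continuity \<open>\<sigma>\<close> stays above \<open>c\<close> for a while
      after \<open>t0\<close>, and so does the ramp \<open>c + (t - t0)\<close>. Hence
      \<open>g\<close> is negative there and \<open>y\<close> drops below
      \<open>y t0 = 0\<close>.\<close>
    obtain d where d: "d > 0" "\<And>s. 0 \<le> s \<Longrightarrow> dist s t0 < d \<Longrightarrow> dist (\<sigma> s) (\<sigma> t0) < \<sigma> t0 - c"
      using \<sigma>_cont[unfolded continuous_on_iff, rule_format, of t0 "\<sigma> t0 - c"] t0 c by auto
    have "y (t0 + d / 2) < y t0"
    proof (rule DERIV_neg_imp_decreasing_open[where f = y])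
      fix s assume s: "t0 < s" "s < t0 + d / 2"
      then have "c < \<sigma> s"
        using d(2)[of s] d(1) t0 by (auto simp: dist_real_def)
      then have "g s < 0"
        using s by (simp add: g_def)
      then show "\<exists>z. (y has_real_derivative z) (at s) \<and> z < 0"
        using y_deriv[of s] s t0 by (auto simp: at_within_atLeast_interior mult_pos_neg)
    next
      have "continuous_on {0..} y"
        using y_deriv by (auto simp: continuous_on_eq_continuous_within intro: DERIV_continuous)
      then show "continuous_on {t0..t0 + d / 2} y"
        by (rule continuous_on_subset) (use t0 in auto)
    qed (use d in simp)
    then have "l (t0 + d / 2) < 0"
      using y_before by (simp add: l_def mult_pos_neg)
    then show ?thesis
      using that[of "t0 + d / 2"] t0 d by simp
  qed
  ultimately show ?thesis
    by (intro that[of \<delta>]) (use assms in \<open>force simp: well_defined_A_def\<close>)+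
qed

lemma PQM3_well_defined_iff:
  assumes "0 < \<Lambda>" "0 < \<epsilon>" "rate_fun \<sigma>"
  shows "(\<forall>\<delta>. rate_fun \<delta> \<longrightarrow> well_defined_A PQM3 \<Lambda> \<epsilon> \<delta> \<sigma>) \<longleftrightarrow> (\<forall>t\<ge>0. \<epsilon> * \<sigma> t \<le> \<Lambda>)"
proof
  assume *: "\<forall>\<delta>. rate_fun \<delta> \<longrightarrow> well_defined_A PQM3 \<Lambda> \<epsilon> \<delta> \<sigma>"
  show "\<forall>t\<ge>0. \<epsilon> * \<sigma> t \<le> \<Lambda>"
  proof (rule ccontr)
    assume "\<not> ?thesis"
    then obtain t where "0 \<le> t" "\<Lambda> < \<epsilon> * \<sigma> t"
      by (auto simp: not_le)
    then obtain \<delta> where "rate_fun \<delta>" "\<not> well_defined_A PQM3 \<Lambda> \<epsilon> \<delta> \<sigma>"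
      by (rule PQM3_not_well_defined[OF assms])
    with * show False
      by blast
  qed
next
  assume "\<forall>t\<ge>0. \<epsilon> * \<sigma> t \<le> \<Lambda>"
  then show "\<forall>\<delta>. rate_fun \<delta> \<longrightarrow> well_defined_A PQM3 \<Lambda> \<epsilon> \<delta> \<sigma>"
    using assms by (auto intro!: well_defined_A_sufficient)
qed

section \<open>Bounds with extended real quotients\<close>

text \<open>For \<open>r = 0\<close> both sides hold: the quotient is infinite and the product is
  0.\<close>

lemma ereal_le_divide_iff_mult_le:
  assumes "0 < \<Lambda>" "0 \<le> r"
  shows "ereal \<epsilon> \<le> ereal \<Lambda> / ereal r \<longleftrightarrow> \<epsilon> * r \<le> \<Lambda>"
  using assms by (cases "r = 0") (simp_all add: divide_ereal_def field_simps)

text \<open>The supremum replaces a maximum that need not be attained. If it is infinite, the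
  quotient is 0 and contradicts \<open>0 < \<epsilon>\<close>; minus infinity is excluded by the
  value at \<open>t\<close>.\<close>

lemma ereal_le_divide_SUP_imp_mult_le:
  assumes "0 < \<Lambda>" "0 < \<epsilon>" "\<And>t. t \<in> A \<Longrightarrow> 0 \<le> r t"
    and le: "ereal \<epsilon> \<le> ereal \<Lambda> / (SUP t\<in>A. ereal (r t))" and "t \<in> A"
  shows "\<epsilon> * r t \<le> \<Lambda>"
proof -
  have upper: "ereal (r t) \<le> (SUP t\<in>A. ereal (r t))"
    using \<open>t \<in> A\<close> by (rule SUP_upper)
  show ?thesis
  proof (cases "SUP t\<in>A. ereal (r t)")
    case (real S)
    then have "0 \<le> r t" "r t \<le> S"
      using upper assms by auto
    moreover have "\<epsilon> * S \<le> \<Lambda>"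
      using le real ereal_le_divide_iff_mult_le[of \<Lambda> S \<epsilon>] assms calculation by simp
    moreover have "\<epsilon> * r t \<le> \<epsilon> * S"
      using calculation assms by simp
    ultimately show ?thesis
      by linarith
  qed (use le upper assms in \<open>auto simp: divide_ereal_def\<close>)
qed

theorem theorem4p1:
  fixes \<Lambda> \<epsilon> :: real
  assumes "0 < \<Lambda>" and "0 < \<epsilon>"
  shows
    "(\<forall>\<delta> \<sigma>. rate_fun \<delta> \<and> rate_fun \<sigma> \<longrightarrow>
        well_defined_A PQM1 \<Lambda> \<epsilon> \<delta> \<sigma> \<and> well_defined_B PQM1 \<Lambda> \<epsilon> \<delta> \<sigma> \<and>
        well_defined_A PQM2 \<Lambda> \<epsilon> \<delta> \<sigma> \<and> well_defined_B PQM2 \<Lambda> \<epsilon> \<delta> \<sigma>) \<and>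
     (\<forall>\<sigma>. rate_fun \<sigma> \<longrightarrow>
        ((\<forall>\<delta>. rate_fun \<delta> \<longrightarrow> well_defined_A PQM3 \<Lambda> \<epsilon> \<delta> \<sigma>) \<longleftrightarrow>
          (\<forall>t\<ge>0. ereal \<epsilon> \<le> ereal \<Lambda> / ereal (\<sigma> t))) \<and>
        ((\<forall>\<delta>. rate_fun \<delta> \<longrightarrow> well_defined_B PQM3 \<Lambda> \<epsilon> \<delta> \<sigma>) \<longleftrightarrow>
          (\<forall>t\<ge>0. ereal \<epsilon> \<le> ereal \<Lambda> / ereal (\<sigma> t)))) \<and>
     (\<forall>\<delta>. rate_fun \<delta> \<longrightarrow>
        ((\<forall>\<sigma>. rate_fun \<sigma> \<longrightarrow> well_defined_A PQM4 \<Lambda> \<epsilon> \<delta> \<sigma>) \<longleftrightarrow>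
          (\<forall>t\<ge>0. ereal \<epsilon> \<le> ereal \<Lambda> / ereal (\<delta> t))) \<and>
        ((\<forall>\<sigma>. rate_fun \<sigma> \<longrightarrow> well_defined_B PQM4 \<Lambda> \<epsilon> \<delta> \<sigma>) \<longleftrightarrow>
          (\<forall>t\<ge>0. ereal \<epsilon> \<le> ereal \<Lambda> / ereal (\<delta> t)))) \<and>
     (\<forall>\<delta> \<sigma>. rate_fun \<delta> \<and> rate_fun \<sigma> \<and>
        ereal \<epsilon> \<le> ereal \<Lambda> / (SUP t\<in>{0..}. ereal (max (\<delta> t) (\<sigma> t))) \<longrightarrow>
        (\<forall>m. well_defined_A m \<Lambda> \<epsilon> \<delta> \<sigma> \<and> well_defined_B m \<Lambda> \<epsilon> \<delta> \<sigma>))"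
proof (intro conjI allI impI; (elim conjE)?)
  fix \<delta> \<sigma> :: "real \<Rightarrow> real"
  assume r: "rate_fun \<delta>" "rate_fun \<sigma>"
  then show "well_defined_A PQM1 \<Lambda> \<epsilon> \<delta> \<sigma>" "well_defined_A PQM2 \<Lambda> \<epsilon> \<delta> \<sigma>"
    using assms by (auto intro!: well_defined_A_sufficient)
  with r show "well_defined_B PQM1 \<Lambda> \<epsilon> \<delta> \<sigma>" "well_defined_B PQM2 \<Lambda> \<epsilon> \<delta> \<sigma>"
    using assms by (simp_all add: well_defined_B_iff_A)
next
  fix \<sigma> :: "real \<Rightarrow> real"
  assume \<sigma>: "rate_fun \<sigma>"
  then have "(\<forall>t\<ge>0. ereal \<epsilon> \<le> ereal \<Lambda> / ereal (\<sigma> t)) \<longleftrightarrow> (\<forall>t\<ge>0. \<epsilon> * \<sigma> t \<le> \<Lambda>)"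
    using assms by (auto simp: rate_fun_def ereal_le_divide_iff_mult_le simp del: ereal_divide)
  with \<sigma> show "(\<forall>\<delta>. rate_fun \<delta> \<longrightarrow> well_defined_A PQM3 \<Lambda> \<epsilon> \<delta> \<sigma>) \<longleftrightarrow>
      (\<forall>t\<ge>0. ereal \<epsilon> \<le> ereal \<Lambda> / ereal (\<sigma> t))"
    using PQM3_well_defined_iff assms by blast
  then show "(\<forall>\<delta>. rate_fun \<delta> \<longrightarrow> well_defined_B PQM3 \<Lambda> \<epsilon> \<delta> \<sigma>) \<longleftrightarrow>
      (\<forall>t\<ge>0. ereal \<epsilon> \<le> ereal \<Lambda> / ereal (\<sigma> t))"
    using \<sigma> assms well_defined_B_iff_A by blast
next
  fix \<delta> :: "real \<Rightarrow> real"
  assume \<delta>: "rate_fun \<delta>"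
  then have "(\<forall>t\<ge>0. ereal \<epsilon> \<le> ereal \<Lambda> / ereal (\<delta> t)) \<longleftrightarrow> (\<forall>t\<ge>0. \<epsilon> * \<delta> t \<le> \<Lambda>)"
    using assms by (auto simp: rate_fun_def ereal_le_divide_iff_mult_le simp del: ereal_divide)
  \<comment> \<open>Duality turns the quantified supply of PQM4 into the quantified demand of PQM3,
    so the PQM3 equivalence applies with \<open>\<delta>\<close> as the supply.\<close>
  moreover have "well_defined_A PQM4 \<Lambda> \<epsilon> \<delta> \<sigma> \<longleftrightarrow> well_defined_A PQM3 \<Lambda> \<epsilon> \<sigma> \<delta>" for \<sigma>
    using well_defined_A_dual[of PQM3 \<Lambda> \<epsilon> \<delta> \<sigma>] by simp
  ultimately show "(\<forall>\<sigma>. rate_fun \<sigma> \<longrightarrow> well_defined_A PQM4 \<Lambda> \<epsilon> \<delta> \<sigma>) \<longleftrightarrow>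
      (\<forall>t\<ge>0. ereal \<epsilon> \<le> ereal \<Lambda> / ereal (\<delta> t))"
    using PQM3_well_defined_iff \<delta> assms by blast
  then show "(\<forall>\<sigma>. rate_fun \<sigma> \<longrightarrow> well_defined_B PQM4 \<Lambda> \<epsilon> \<delta> \<sigma>) \<longleftrightarrow>
      (\<forall>t\<ge>0. ereal \<epsilon> \<le> ereal \<Lambda> / ereal (\<delta> t))"
    using \<delta> assms well_defined_B_iff_A by blast
next
  fix \<delta> \<sigma> :: "real \<Rightarrow> real" and m
  assume r: "rate_fun \<delta>" "rate_fun \<sigma>"
    and le: "ereal \<epsilon> \<le> ereal \<Lambda> / (SUP t\<in>{0..}. ereal (max (\<delta> t) (\<sigma> t)))"
  have bound: "\<epsilon> * max (\<delta> t) (\<sigma> t) \<le> \<Lambda>" if "0 \<le> t" for t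
    using ereal_le_divide_SUP_imp_mult_le[OF assms _ le, of t] r that
    by (auto simp: rate_fun_def le_max_iff_disj)
  have "\<epsilon> * \<delta> t \<le> \<Lambda>" "\<epsilon> * \<sigma> t \<le> \<Lambda>" if "0 \<le> t" for t
    using bound[OF that] assms mult_left_mono[of "\<delta> t" "max (\<delta> t) (\<sigma> t)" \<epsilon>]
      mult_left_mono[of "\<sigma> t" "max (\<delta> t) (\<sigma> t)" \<epsilon>] by linarith+
  with r show "well_defined_A m \<Lambda> \<epsilon> \<delta> \<sigma>"
    using assms by (intro well_defined_A_sufficient) auto
  with r show "well_defined_B m \<Lambda> \<epsilon> \<delta> \<sigma>"
    using assms by (simp add: well_defined_B_iff_A)
qed

end
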